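(* Let $S=(V,\mathcal{H})$ be a paving simplicial complex of dimension $d$, and let $$\tau(S)=\{(V,\mathcal{H}')\in\mathrm{TBPav}(d) : \mathcal{H}'\subseteq\mathcal{H}\}\cup\{(V,P_{\leq d}(V))\}.$$ Then (i) there exists a unique $S^0=(V,\mathcal{H}^0)\in\tau(S)$ such that $\mathcal{H}'\subseteq\mathcal{H}^0$ for every $(V,\mathcal{H}')\in\tau(S)$; and (ii) $S^0=T_{d+1}(S^{\varepsilon})$.
   Context: A (finite) simplicial complex is a pair $S=(V,\mathcal{H})$ where $V$ is a finite nonempty set and $\mathcal{H}\subseteq 2^V$ contains all singletons and is closed under taking subsets. Its dimension is $\max\{|I|:I\in\mathcal{H}\}-1$. $P_n(V)$ (resp. $P_{\leq n}(V)$) denotes the set of subsets of $V$ with exactly (resp. at most) $n$ elements. $S$ is paving if $P_{\dim S}(V)\subseteq\mathcal{H}$. A flat of $S$ is $X\subseteq V$ with $I\cup\{p\}\in\mathcal{H}$ for all $I\in\mathcal{H}\cap 2^X$, $p\in V\setminus X$. For a family $\mathcal{F}\subseteq 2^V$ containing $V$ and closed under intersection (a Moore family), $\mathrm{Tr}(\mathcal{F})$ denotes the set of $X\subseteq V$ admitting an enumeration $x_1,\dots,x_k$ and a chain $F_0\subset F_1\subset\cdots\subset F_k$ in $\mathcal{F}$ with $x_i\in F_i\setminus F_{i-1}$. $S$ is boolean representable (BRSC) if $\mathcal{H}$ equals the set of $M$-independent column sets of some boolean matrix $M$ (a column set $X$ is $M$-independent if some square submatrix on columns $X$ is congruent to a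 lower unitriangular boolean matrix); equivalently $\mathcal{H}=\mathrm{Tr}(\text{set of flats of }S)$. For $k\geq1$, $T_k(S)=(V,\mathcal{H}\cap P_{\leq k}(V))$; $S$ is a TBRSC if $S=T_k(S')$ for some BRSC $S'$ and $k\geq1$; $\mathrm{TBPav}(d)$ is the class of paving TBRSCs of dimension $d$. For $S$ of dimension $d$, define $$\varepsilon(S)=\{X\subseteq V : \forall Y\in\mathcal{H}\cap P_{\leq d}(X)\ \forall p\in V\setminus X,\ Y\cup\{p\}\in\mathcal{H}\},$$ a Moore family, and $S^{\varepsilon}=(V,\mathrm{Tr}(\varepsilon(S)))$. *)

theory Defs
  imports Main
begin

(* A complex S is the pair (V, H) = (fst S, snd S) of vertex set and set of faces. *)
type_synonym 'a scomplex = "'a set \<times> 'a set set"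

definition simplicial_complex :: "'a scomplex \<Rightarrow> bool" where
  "simplicial_complex S \<longleftrightarrow> (case S of (V, H) \<Rightarrow>
     finite V \<and> V \<noteq> {} \<and> H \<subseteq> Pow V \<and> (\<forall>v\<in>V. {v} \<in> H) \<and> (\<forall>I\<in>H. \<forall>J. J \<subseteq> I \<longrightarrow> J \<in> H))"

(* A simplicial complex has a face of size 1, so the natural subtraction does not truncate. *)
definition sdim :: "'a scomplex \<Rightarrow> nat" where
  "sdim S = Max (card ` snd S) - 1"

definition P_eq :: "nat \<Rightarrow> 'a set \<Rightarrow> 'a set set" where
  "P_eq n V = {X. X \<subseteq> V \<and> finite X \<and> card X = n}"

definition P_le :: "nat \<Rightarrow> 'a set \<Rightarrow> 'a set set" where
  "P_le n V = {X. X \<subseteq> V \<and> finite X \<and> card X \<le> n}"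

definition paving :: "'a scomplex \<Rightarrow> bool" where
  "paving S \<longleftrightarrow> simplicial_complex S \<and> P_eq (sdim S) (fst S) \<subseteq> snd S"

definition Tr :: "'a set \<Rightarrow> 'a set set \<Rightarrow> 'a set set" where
  "Tr V \<F> = {X. X \<subseteq> V \<and> (\<exists>k x F. bij_betw x {1..k::nat} X \<and> (\<forall>i\<le>k. F i \<in> \<F>) \<and>
     (\<forall>i\<in>{1..k}. F (i - 1) \<subset> F i \<and> x i \<in> F i - F (i - 1)))}"

definition lower_unitriangular :: "nat \<Rightarrow> (nat \<Rightarrow> nat \<Rightarrow> bool) \<Rightarrow> bool" where
  "lower_unitriangular k N \<longleftrightarrow> (\<forall>i<k. N i i) \<and> (\<forall>i<k. \<forall>j<k. i < j \<longrightarrow> \<not> N i j)"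

(* M is a boolean matrix with rows {..<m} and columns indexed by the vertices; the bijections
   r and c order the rows R and the columns X of a square submatrix, so that they range over
   all matrices congruent to it (obtained by independent row and column permutations). *)
definition M_independent :: "nat \<Rightarrow> (nat \<Rightarrow> 'a \<Rightarrow> bool) \<Rightarrow> 'a set \<Rightarrow> bool" where
  "M_independent m M X \<longleftrightarrow> (\<exists>R r c. R \<subseteq> {..<m} \<and>
     bij_betw r {..<card X} R \<and> bij_betw c {..<card X} X \<and>
     lower_unitriangular (card X) (\<lambda>i j. M (r i) (c j)))"

definition BRSC :: "'a scomplex \<Rightarrow> bool" where
  "BRSC S \<longleftrightarrow> simplicial_complex S \<and>
     (\<exists>m M. snd S = {X. X \<subseteq> fst S \<and> M_independent m M X})"

definition truncation :: "nat \<Rightarrow> 'a scomplex \<Rightarrow> 'a scomplex" where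
  "truncation k S = (fst S, snd S \<inter> P_le k (fst S))"

definition TBRSC :: "'a scomplex \<Rightarrow> bool" where
  "TBRSC S \<longleftrightarrow> (\<exists>S' k. BRSC S' \<and> k \<ge> 1 \<and> S = truncation k S')"

definition TBPav :: "nat \<Rightarrow> 'a scomplex set" where
  "TBPav d = {S. TBRSC S \<and> paving S \<and> sdim S = d}"

definition eps :: "'a scomplex \<Rightarrow> 'a set set" where
  "eps S = (case S of (V, H) \<Rightarrow>
     {X. X \<subseteq> V \<and> (\<forall>Y \<in> H \<inter> P_le (sdim S) X. \<forall>p \<in> V - X. Y \<union> {p} \<in> H)})"

definition eps_complex :: "'a scomplex \<Rightarrow> 'a scomplex" where
  "eps_complex S = (fst S, Tr (fst S) (eps S))"

definition tau :: "'a scomplex \<Rightarrow> 'a scomplex set" where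
  "tau S = (case S of (V, H) \<Rightarrow>
     {(V, H') | H'. (V, H') \<in> TBPav (sdim S) \<and> H' \<subseteq> H} \<union> {(V, P_le (sdim S) V)})"

end

(* Both boolean representability and transversals of chains reduce to one greedy construction:
   start from the empty set and adjoin points x outside some member F of a family, where F
   contains everything adjoined so far. For a boolean matrix the family consists of the zero
   sets of the rows. If a paving TBRSC of dimension d lies below H, the zero sets of a matrix
   representing it belong to eps (V, H), because every set of size at most d is independent;
   hence the complex lies below the truncation of the complex of eps (V, H). That truncation
   is in turn contained in H by the definition of eps, and contains all sets of size at most d. *)

theory Submission
  imports Defs
begin

section \<open>Sets built by leaving members of a family\<close>

text \<open>The members \<open>F\<close> left at successive steps need not be nested, so families
  without intersection closure are allowed, such as the zero sets of matrix rows.\<close>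

inductive_set transversals :: "'a set \<Rightarrow> 'a set set \<Rightarrow> 'a set set"
  for V :: "'a set" and \<F> :: "'a set set" where
  empty: "{} \<in> transversals V \<F>"
| insert: "X \<in> transversals V \<F> \<Longrightarrow> F \<in> \<F> \<Longrightarrow> X \<subseteq> F \<Longrightarrow> x \<in> V - F
    \<Longrightarrow> insert x X \<in> transversals V \<F>"

lemma transversals_subset: "X \<in> transversals V \<F> \<Longrightarrow> X \<subseteq> V"
  by (induction rule: transversals.induct) auto

lemma transversals_finite: "X \<in> transversals V \<F> \<Longrightarrow> finite X"
  by (induction rule: transversals.induct) auto

lemma transversals_mono:
  assumes "\<F> \<subseteq> \<G>"
  shows "transversals V \<F> \<subseteq> transversals V \<G>"
proof
  fix X assume "X \<in> transversals V \<F>"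
  then show "X \<in> transversals V \<G>"
    by (induction rule: transversals.induct) (use assms in \<open>auto intro: transversals.intros\<close>)
qed

text \<open>Omitting points keeps the other steps valid: each member used still contains what was
  adjoined before and still misses the new point.\<close>

lemma transversals_down_closed:
  assumes "X \<in> transversals V \<F>" and "J \<subseteq> X"
  shows "J \<in> transversals V \<F>"
  using assms
proof (induction arbitrary: J rule: transversals.induct)
  case empty
  then show ?case by (simp add: transversals.empty)
next
  case (insert X F x)
  show ?case
  proof (cases "x \<in> J")
    case True
    have "J - {x} \<in> transversals V \<F>" using insert by blast
    then have "insert x (J - {x}) \<in> transversals V \<F>"
      using insert by (intro transversals.insert[of _ _ _ F]) auto
    then show ?thesis using True by (simp add: insert_absorb)
  next
    case False
    then show ?thesis using insert by blast
  qed
qed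

lemma Tr_subset_transversals: "Tr V \<F> \<subseteq> transversals V \<F>"
proof
  fix X assume "X \<in> Tr V \<F>"
  then obtain k x F where X: "X \<subseteq> V" and bij: "bij_betw x {1..k::nat} X"
    and F: "\<And>i. i \<le> k \<Longrightarrow> F i \<in> \<F>"
    and step: "\<And>i. i \<in> {1..k} \<Longrightarrow> F (i - 1) \<subset> F i \<and> x i \<in> F i - F (i - 1)"
    unfolding Tr_def by blast
  \<comment> \<open>Carrying the inclusion in \<open>F i\<close> along makes \<open>F i\<close> the
    member that the next point leaves.\<close>
  have "x ` {1..i} \<in> transversals V \<F> \<and> x ` {1..i} \<subseteq> F i" if "i \<le> k" for i
    using that
  proof (induction i)
    case 0
    then show ?case by (simp add: transversals.empty)
  next
    case (Suc i)
    have s: "F i \<subset> F (Suc i)" "x (Suc i) \<in> F (Suc i) - F i"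
      using step[of "Suc i"] Suc.prems by auto
    have "x (Suc i) \<in> V" using X bij Suc.prems by (auto simp: bij_betw_def)
    moreover have "x ` {1..Suc i} = insert (x (Suc i)) (x ` {1..i})"
      by (simp add: atLeastAtMostSuc_conv)
    ultimately show ?case
      using Suc s F[of i] transversals.insert[of "x ` {1..i}" V \<F> "F i" "x (Suc i)"] by auto
  qed
  from this[of k] show "X \<in> transversals V \<F>" using bij by (simp add: bij_betw_def)
qed

text \<open>The chain is made increasing by intersecting every member with all later ones, which is
  what generalizing over the top member \<open>G\<close> achieves.\<close>

lemma transversals_chain:
  assumes "X \<in> transversals V \<F>" and "G \<in> \<F>" and "X \<subseteq> G"
    and inter: "\<And>A B. A \<in> \<F> \<Longrightarrow> B \<in> \<F> \<Longrightarrow> A \<inter> B \<in> \<F>"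
  shows "\<exists>k x F. bij_betw x {1..k::nat} X \<and> (\<forall>i\<le>k. F i \<in> \<F>) \<and>
    (\<forall>i\<in>{1..k}. F (i - 1) \<subset> F i \<and> x i \<in> F i - F (i - 1)) \<and> F k = G"
  using assms(1-3)
proof (induction arbitrary: G rule: transversals.induct)
  case empty
  then show ?case
    by (intro exI[of _ 0] exI[of _ undefined] exI[of _ "\<lambda>_. G"]) (auto simp: bij_betw_def)
next
  case (insert X E a)
  \<comment> \<open>\<open>E \<inter> G\<close> contains \<open>X\<close> and misses
    \<open>a\<close>, while \<open>G\<close> contains \<open>a\<close>; so a chain for
    \<open>X\<close> with top \<open>E \<inter> G\<close> extends strictly by
    \<open>G\<close>.\<close>
  have "E \<inter> G \<in> \<F>" "X \<subseteq> E \<inter> G" using insert inter by auto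
  from insert.IH[OF this] obtain k x F where bij: "bij_betw x {1..k::nat} X" and F: "\<forall>i\<le>k. F i \<in> \<F>"
    and step: "\<forall>i\<in>{1..k}. F (i - 1) \<subset> F i \<and> x i \<in> F i - F (i - 1)" and top: "F k = E \<inter> G"
    by (elim exE conjE) (rule that)
  let ?x = "x(Suc k := a)" and ?F = "F(Suc k := G)"
  have "bij_betw ?x {1..k} X"
    using bij by (subst bij_betw_cong[of _ _ x]) auto
  then have "bij_betw ?x ({1..k} \<union> {Suc k}) (X \<union> {a})"
    using insert by (intro bij_betw_combine) (auto simp: bij_betw_def)
  then have "bij_betw ?x {1..Suc k} (insert a X)"
    by (simp add: atLeastAtMostSuc_conv)
  moreover have "\<forall>i\<le>Suc k. ?F i \<in> \<F>" using F insert by auto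
  moreover have "\<forall>i\<in>{1..Suc k}. ?F (i - 1) \<subset> ?F i \<and> ?x i \<in> ?F i - ?F (i - 1)"
  proof
    fix i assume "i \<in> {1..Suc k}"
    then show "?F (i - 1) \<subset> ?F i \<and> ?x i \<in> ?F i - ?F (i - 1)"
      using step top insert by (cases "i = Suc k") auto
  qed
  ultimately show ?case
    by (intro exI[of _ "Suc k"] exI[of _ ?x] exI[of _ ?F] conjI fun_upd_same)
qed

text \<open>Every transversal lies in \<open>V\<close>, which can therefore be the top of its
  chain.\<close>

lemma Tr_eq_transversals:
  assumes "V \<in> \<F>" and "\<And>A B. A \<in> \<F> \<Longrightarrow> B \<in> \<F> \<Longrightarrow> A \<inter> B \<in> \<F>"
  shows "Tr V \<F> = transversals V \<F>"
proof
  show "transversals V \<F> \<subseteq> Tr V \<F>"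
  proof
    fix X assume X: "X \<in> transversals V \<F>"
    note XV = transversals_subset[OF X]
    show "X \<in> Tr V \<F>"
      unfolding Tr_def using transversals_chain[OF X assms(1) XV assms(2)] XV by blast
  qed
qed (rule Tr_subset_transversals)

section \<open>Boolean matrices\<close>

text \<open>Distinctness of the rows of a unitriangular submatrix is automatic.\<close>

lemma M_independent_iff:
  "M_independent m M X \<longleftrightarrow> (\<exists>r c. r ` {..<card X} \<subseteq> {..<m} \<and> bij_betw c {..<card X} X \<and>
     lower_unitriangular (card X) (\<lambda>i j. M (r i) (c j)))" (is "?L \<longleftrightarrow> ?R")
proof
  assume ?L
  then show ?R unfolding M_independent_def bij_betw_def by blast
next
  assume ?R
  then obtain r c where r: "r ` {..<card X} \<subseteq> {..<m}" and c: "bij_betw c {..<card X} X"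
    and lu: "lower_unitriangular (card X) (\<lambda>i j. M (r i) (c j))" by blast
  have "inj_on r {..<card X}"
  proof (rule linorder_inj_onI')
    fix i j assume "i \<in> {..<card X}" "j \<in> {..<card X}" "i < j"
    then have "\<not> M (r i) (c j)" "M (r j) (c j)" using lu by (auto simp: lower_unitriangular_def)
    then show "r i \<noteq> r j" by auto
  qed
  then have "bij_betw r {..<card X} (r ` {..<card X})" by (simp add: bij_betw_def)
  then show ?L unfolding M_independent_def using r c lu by blast
qed

text \<open>Row \<open>i\<close> of a lower unitriangular submatrix vanishes on all later columns
  but not on its own, so column \<open>i\<close> leaves the zero set of row \<open>i\<close> once
  the later columns are adjoined.\<close>

lemma M_independent_eq_transversals:
  fixes V :: "'a set"
  assumes "finite V"
  shows "{X. X \<subseteq> V \<and> M_independent m M X} =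
    transversals V ((\<lambda>i. {v \<in> V. \<not> M i v}) ` {..<m})" (is "?L = transversals V ?Z")
proof (intro equalityI subsetI)
  fix X assume "X \<in> ?L"
  then obtain r c where X: "X \<subseteq> V" and r: "r ` {..<card X} \<subseteq> {..<m}"
    and c: "bij_betw c {..<card X} X"
    and lu: "lower_unitriangular (card X) (\<lambda>i j. M (r i) (c j))"
    unfolding M_independent_iff by blast
  have cV: "c i \<in> V" if "i < card X" for i using c X that by (auto simp: bij_betw_def)
  \<comment> \<open>Columns are adjoined from last to first, hence the downward induction from
    \<open>card X\<close>.\<close>
  have "c ` {i..<card X} \<in> transversals V ?Z" if "i \<le> card X" for i
    using that
  proof (induction rule: inc_induct)
    case base
    show ?case by (simp add: transversals.empty)
  next
    case (step i)
    let ?F = "{v \<in> V. \<not> M (r i) v}"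
    have "?F \<in> ?Z" using r step by auto
    moreover have "c ` {Suc i..<card X} \<subseteq> ?F" "c i \<in> V - ?F"
      using lu step cV by (auto simp: lower_unitriangular_def)
    ultimately have "insert (c i) (c ` {Suc i..<card X}) \<in> transversals V ?Z"
      using step by (intro transversals.insert) auto
    moreover have "{i..<card X} = insert i {Suc i..<card X}" using step by auto
    ultimately show ?case by simp
  qed
  from this[of 0] show "X \<in> transversals V ?Z"
    using c by (simp add: bij_betw_def atLeast0LessThan)
next
  fix X assume X: "X \<in> transversals V ?Z"
  then have "M_independent m M X"
  proof (induction rule: transversals.induct)
    case empty
    show ?case by (simp add: M_independent_iff lower_unitriangular_def bij_betw_def)
  next
    case (insert X F x)
    from \<open>M_independent m M X\<close> obtain r c where r: "r ` {..<card X} \<subseteq> {..<m}"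
      and c: "bij_betw c {..<card X} X"
      and lu: "lower_unitriangular (card X) (\<lambda>i j. M (r i) (c j))"
      unfolding M_independent_iff by blast
    from insert obtain s where s: "s < m" "F = {v \<in> V. \<not> M s v}" by auto
    have x: "x \<notin> X" "M s x" using insert s by auto
    have card: "card (insert x X) = Suc (card X)"
      using x transversals_finite[OF insert.hyps(1)] by simp
    \<comment> \<open>The new row and column get index 0 and the old indices shift up by one. Row
      \<open>s\<close> vanishes on \<open>X\<close>, which gives the zeros right of the first
      diagonal entry; the entries below it are arbitrary.\<close>
    let ?r = "case_nat s r" and ?c = "case_nat x c"
    have "?r ` {..<Suc (card X)} \<subseteq> {..<m}" using r s by (auto simp: lessThan_Suc_eq_insert_0)
    moreover have "bij_betw ?c {..<Suc (card X)} (insert x X)"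
      using c x by (auto simp: lessThan_Suc_eq_insert_0 bij_betw_def inj_on_def image_image)
    moreover have "\<not> M s (c j)" if "j < card X" for j
      using that c insert s by (auto simp: bij_betw_def)
    then have "lower_unitriangular (Suc (card X)) (\<lambda>i j. M (?r i) (?c j))"
      using lu x by (auto simp: lower_unitriangular_def split: nat.splits)
    ultimately show ?case unfolding M_independent_iff card by blast
  qed
  then show "X \<in> ?L" using transversals_subset[OF X] by simp
qed

lemma BRSC_iff_transversals:
  "BRSC (V, H) \<longleftrightarrow> simplicial_complex (V, H) \<and> (\<exists>\<F> \<subseteq> Pow V. H = transversals V \<F>)"
  (is "_ \<longleftrightarrow> _ \<and> ?R")
proof -
  have "(\<exists>m M. H = {X. X \<subseteq> V \<and> M_independent m M X}) \<longleftrightarrow> ?R" if V: "finite V"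
  proof
    assume "\<exists>m M. H = {X. X \<subseteq> V \<and> M_independent m M X}"
    then obtain m M where "H = {X. X \<subseteq> V \<and> M_independent m M X}" by blast
    then have "H = transversals V ((\<lambda>i. {v \<in> V. \<not> M i v}) ` {..<m})"
      by (simp only: M_independent_eq_transversals[OF V])
    moreover have "(\<lambda>i. {v \<in> V. \<not> M i v}) ` {..<m} \<subseteq> Pow V" by blast
    ultimately show ?R by blast
  next
    assume ?R
    then obtain \<F> where \<F>: "\<F> \<subseteq> Pow V" and H: "H = transversals V \<F>" by blast
    have "finite \<F>" using V \<F> by (meson finite_Pow_iff finite_subset)
    then obtain f and n :: nat where f: "\<F> = f ` {..<n}"
      by (metis finite_imp_nat_seg_image_inj_on lessThan_def)
    \<comment> \<open>The entry \<open>v \<notin> f i\<close> makes \<open>f i\<close> the zero set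
      of row \<open>i\<close>, since every member of \<open>\<F>\<close> lies in
      \<open>V\<close>.\<close>
    have "(\<lambda>i. {v \<in> V. \<not> (v \<notin> f i)}) ` {..<n} = \<F>"
      unfolding f by (rule image_cong) (use \<F> f in auto)
    then have "H = {X. X \<subseteq> V \<and> M_independent n (\<lambda>i v. v \<notin> f i) X}"
      by (simp only: H M_independent_eq_transversals[OF V])
    then show "\<exists>m M. H = {X. X \<subseteq> V \<and> M_independent m M X}" by (intro exI)
  qed
  moreover have "simplicial_complex (V, H) \<Longrightarrow> finite V" by (simp add: simplicial_complex_def)
  ultimately show ?thesis unfolding BRSC_def fst_conv snd_conv by blast
qed

section \<open>Paving complexes\<close>

lemma simplicial_complex_finite_faces:
  assumes "simplicial_complex (V, H)"
  shows "finite H"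
proof -
  have "H \<subseteq> Pow V" "finite V" using assms by (auto simp: simplicial_complex_def)
  then show ?thesis by (meson finite_Pow_iff finite_subset)
qed

lemma sdim_face_card:
  assumes "simplicial_complex (V, H)" and "X \<in> H"
  shows "card X \<le> Suc (sdim (V, H))"
proof -
  have "card X \<le> Max (card ` H)"
    using simplicial_complex_finite_faces[OF assms(1)] assms(2) by simp
  then show ?thesis by (simp add: sdim_def)
qed

lemma sdim_attained:
  assumes "simplicial_complex (V, H)"
  obtains X where "X \<in> H" "card X = Suc (sdim (V, H))"
proof -
  have fin: "finite (card ` H)" using simplicial_complex_finite_faces[OF assms] by simp
  from assms obtain v where "{v} \<in> H" by (auto simp: simplicial_complex_def)
  then have v: "card {v} \<in> card ` H" by (rule imageI)
  \<comment> \<open>A vertex makes the maximum positive, so \<open>Suc\<close> undoes the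
    subtraction in \<open>sdim\<close>.\<close>
  have "1 \<le> Max (card ` H)" using Max_ge[OF fin v] by simp
  moreover have "Max (card ` H) \<in> card ` H" using fin v by (intro Max_in) auto
  then obtain X where "X \<in> H" "card X = Max (card ` H)" by auto
  ultimately show thesis using that by (simp add: sdim_def)
qed

lemma sdim_eqI:
  assumes "finite H" and "X \<in> H" and "card X = Suc d" and "\<And>Y. Y \<in> H \<Longrightarrow> card Y \<le> Suc d"
  shows "sdim (V, H) = d"
proof -
  have "Max (card ` H) = Suc d" using assms by (intro Max_eqI) force+
  then show ?thesis by (simp add: sdim_def)
qed

text \<open>A face of maximal size shows that \<open>V\<close> has more than
  \<open>sdim (V, H)\<close> points, so a smaller set extends to one of exactly that size, which is
  a face by paving.\<close>

lemma paving_P_le_subset: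
  assumes "paving (V, H)"
  shows "P_le (sdim (V, H)) V \<subseteq> H"
proof
  fix X assume X: "X \<in> P_le (sdim (V, H)) V"
  have sc: "simplicial_complex (V, H)" and P: "P_eq (sdim (V, H)) V \<subseteq> H"
    using assms by (auto simp: paving_def)
  then have fin: "finite V" by (simp add: simplicial_complex_def)
  obtain Y where Y: "Y \<in> H" "card Y = Suc (sdim (V, H))" using sdim_attained[OF sc] .
  then have "Y \<subseteq> V" using sc by (auto simp: simplicial_complex_def)
  then have "Suc (sdim (V, H)) \<le> card V" using card_mono[OF fin] Y by metis
  then obtain B where "X \<subseteq> B" "B \<subseteq> V" "card B = sdim (V, H)"
    using X fin exists_subset_between[of X "sdim (V, H)" V] by (auto simp: P_le_def)
  then have "B \<in> H" using P fin by (auto simp: P_eq_def intro: finite_subset)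
  then show "X \<in> H" using sc \<open>X \<subseteq> B\<close> by (auto simp: simplicial_complex_def)
qed

section \<open>The family \<open>eps\<close> and its transversals\<close>

lemma eps_iff:
  "X \<in> eps (V, H) \<longleftrightarrow>
    X \<subseteq> V \<and> (\<forall>Y \<in> H \<inter> P_le (sdim (V, H)) X. \<forall>p \<in> V - X. insert p Y \<in> H)"
  by (simp add: eps_def)

text \<open>A point outside \<open>A \<inter> B\<close> lies outside one of the two sets, whose
  condition then applies to each \<open>Y\<close> in the intersection.\<close>

lemma eps_inter: "A \<in> eps (V, H) \<Longrightarrow> B \<in> eps (V, H) \<Longrightarrow> A \<inter> B \<in> eps (V, H)"
  unfolding eps_iff P_le_def by blast

lemma empty_in_eps:
  assumes "simplicial_complex (V, H)"
  shows "{} \<in> eps (V, H)"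
  using assms by (auto simp: eps_iff P_le_def simplicial_complex_def)

lemma eps_complex_eq: "eps_complex (V, H) = (V, transversals V (eps (V, H)))"
proof -
  have "V \<in> eps (V, H)" by (simp add: eps_iff)
  then show ?thesis by (simp add: eps_complex_def Tr_eq_transversals eps_inter)
qed

text \<open>One more point still gives at most \<open>sdim (V, H)\<close> points, and paving makes
  all such sets faces.\<close>

lemma small_in_eps:
  assumes "paving (V, H)" and "X \<subseteq> V" and "card X < sdim (V, H)"
  shows "X \<in> eps (V, H)"
  unfolding eps_iff
proof (intro conjI ballI)
  fix Y p assume Y: "Y \<in> H \<inter> P_le (sdim (V, H)) X" and p: "p \<in> V - X"
  have "finite X" using assms by (auto simp: paving_def simplicial_complex_def intro: finite_subset)
  then have "card Y \<le> card X" using Y by (auto simp: P_le_def intro: card_mono)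
  then have "card (insert p Y) \<le> sdim (V, H)"
    using Y assms(3) by (auto simp: P_le_def card_insert_if)
  then have "insert p Y \<in> P_le (sdim (V, H)) V" using Y p assms(2) by (auto simp: P_le_def)
  then show "insert p Y \<in> H" using paving_P_le_subset[OF assms(1)] by blast
qed (rule assms)

lemma P_le_subset_transversals_eps:
  assumes "paving (V, H)"
  shows "P_le (sdim (V, H)) V \<subseteq> transversals V (eps (V, H))"
proof
  fix X assume "X \<in> P_le (sdim (V, H)) V"
  then have "finite X" "X \<subseteq> V" "card X \<le> sdim (V, H)" by (auto simp: P_le_def)
  then show "X \<in> transversals V (eps (V, H))"
  proof (induction X rule: finite_induct)
    case empty
    show ?case by (rule transversals.empty)
  next
    case (insert x X)
    \<comment> \<open>The set \<open>X\<close> built so far is small enough to be a member of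
      \<open>eps\<close> itself, and \<open>x\<close> leaves it.\<close>
    then show ?case
      using small_in_eps[OF assms, of X] by (intro transversals.insert[of _ _ _ X]) auto
  qed
qed

text \<open>By the condition in \<open>eps\<close>, adjoining a point to a face with at most
  \<open>sdim (V, H)\<close> points gives a face. The condition says nothing about larger faces,
  hence the size bound.\<close>

lemma transversals_eps_subset:
  assumes "{} \<in> H"
  shows "transversals V (eps (V, H)) \<inter> P_le (Suc (sdim (V, H))) V \<subseteq> H"
proof -
  have "card X \<le> Suc (sdim (V, H)) \<longrightarrow> X \<in> H" if "X \<in> transversals V (eps (V, H))" for X
    using that
  proof (induction rule: transversals.induct)
    case empty
    show ?case using assms by simp
  next
    case (insert X F x)
    have "finite X" "x \<notin> X" using transversals_finite insert by auto
    then show ?case using insert by (auto simp: eps_iff P_le_def)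
  qed
  then show ?thesis by (auto simp: P_le_def)
qed

section \<open>The greatest element of \<open>tau\<close>\<close>

lemma TBPav_subset_transversals_eps:
  assumes "(V, K) \<in> TBPav (sdim (V, H))" and "K \<subseteq> H"
  shows "K \<subseteq> transversals V (eps (V, H)) \<inter> P_le (Suc (sdim (V, H))) V"
proof -
  let ?d = "sdim (V, H)"
  from assms have pav: "paving (V, K)" and dim: "sdim (V, K) = ?d" and "TBRSC (V, K)"
    by (auto simp: TBPav_def)
  then obtain W L k where "BRSC (W, L)" "(V, K) = truncation k (W, L)"
    unfolding TBRSC_def by (metis surj_pair)
  then have L: "BRSC (V, L)" and K: "K = L \<inter> P_le k V" by (auto simp: truncation_def)
  obtain \<F> where \<F>: "\<F> \<subseteq> Pow V" and L: "L = transversals V \<F>"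
    using L unfolding BRSC_iff_transversals by blast
  have sc: "simplicial_complex (V, K)" using pav by (simp add: paving_def)
  obtain B where "B \<in> K" "card B = Suc ?d" using sdim_attained[OF sc] dim by metis
  \<comment> \<open>The truncation keeps a face of size \<open>Suc ?d\<close>, so it also keeps
    every \<open>insert p Y\<close> with \<open>Y\<close> of size at most \<open>?d\<close>.\<close>
  then have k: "Suc ?d \<le> k" using K by (auto simp: P_le_def)
  have "\<F> \<subseteq> eps (V, H)"
  proof
    fix F assume F: "F \<in> \<F>"
    show "F \<in> eps (V, H)" unfolding eps_iff
    proof (intro conjI ballI)
      show "F \<subseteq> V" using F \<F> by blast
      fix Y p assume Y: "Y \<in> H \<inter> P_le ?d F" and p: "p \<in> V - F"
      then have "Y \<in> P_le ?d V" using \<open>F \<subseteq> V\<close> by (auto simp: P_le_def)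
      \<comment> \<open>Paving is applied to \<open>K\<close>, which has the same dimension: this
        places \<open>Y\<close> in \<open>L\<close> and not merely in \<open>H\<close>.\<close>
      then have "Y \<in> L" using paving_P_le_subset[OF pav] dim K by auto
      then have "insert p Y \<in> L"
        unfolding L using F Y p by (intro transversals.insert[of _ _ _ F]) (auto simp: P_le_def)
      moreover have "insert p Y \<in> P_le k V"
        using Y p k \<open>F \<subseteq> V\<close> by (auto simp: P_le_def card_insert_if)
      ultimately show "insert p Y \<in> H" using K assms(2) by blast
    qed
  qed
  then have "L \<subseteq> transversals V (eps (V, H))" unfolding L by (rule transversals_mono)
  then have "K \<subseteq> transversals V (eps (V, H))" using K by blast
  moreover have "K \<subseteq> P_le (Suc ?d) V"
    using sdim_face_card[OF sc] dim K by (auto simp: P_le_def)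
  ultimately show ?thesis by blast
qed

text \<open>If the truncation has no face of size \<open>Suc (sdim (V, H))\<close>, it is the
  exceptional member of \<open>tau\<close>; otherwise such a face gives it the dimension required by
  \<open>TBPav\<close>.\<close>

lemma transversals_eps_in_tau:
  assumes "paving (V, H)"
  shows "(V, transversals V (eps (V, H)) \<inter> P_le (Suc (sdim (V, H))) V) \<in> tau (V, H)"
proof -
  let ?d = "sdim (V, H)" and ?T = "transversals V (eps (V, H))"
  let ?K = "?T \<inter> P_le (Suc ?d) V"
  have sc: "simplicial_complex (V, H)" using assms by (simp add: paving_def)
  then have V: "finite V" "V \<noteq> {}" by (auto simp: simplicial_complex_def)
  have P: "P_le ?d V \<subseteq> ?K"
    using P_le_subset_transversals_eps[OF assms] by (auto simp: P_le_def)
  show ?thesis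
  proof (cases "?K = P_le ?d V")
    case True
    then show ?thesis by (simp add: tau_def)
  next
    case False
    then obtain X where X: "X \<in> ?K" "card X = Suc ?d" using P by (fastforce simp: P_le_def)
    \<comment> \<open>Leaving the empty member of \<open>eps\<close> covers dimension 0 too, where
      \<open>P\<close> only provides the empty face.\<close>
    have single: "{v} \<in> ?T" if "v \<in> V" for v
      using transversals.insert[OF transversals.empty empty_in_eps[OF sc]] that by simp
    have scT: "simplicial_complex (V, ?T)"
      using V single by (auto simp: simplicial_complex_def transversals_subset
          intro: transversals_down_closed dest: transversals_subset)
    have "eps (V, H) \<subseteq> Pow V" by (auto simp: eps_iff)
    then have "BRSC (V, ?T)"
      unfolding BRSC_iff_transversals using scT by blast
    then have "TBRSC (V, ?K)"
      unfolding TBRSC_def by (intro exI[of _ "(V, ?T)"] exI[of _ "Suc ?d"])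
        (simp add: truncation_def)
    moreover have scK: "simplicial_complex (V, ?K)"
      using scT unfolding simplicial_complex_def P_le_def
      by (auto intro: finite_subset order.trans[OF card_mono])
    moreover have dim: "sdim (V, ?K) = ?d"
      using X by (intro sdim_eqI simplicial_complex_finite_faces[OF scK]) (auto simp: P_le_def)
    moreover have "paving (V, ?K)"
      using scK P dim by (auto simp: paving_def P_eq_def P_le_def)
    moreover have "?K \<subseteq> H"
      using sc V by (intro transversals_eps_subset) (auto simp: simplicial_complex_def)
    ultimately show ?thesis by (simp add: tau_def TBPav_def)
  qed
qed

theorem theorem5p11:
  fixes V :: "'a set" and H :: "'a set set" and d :: nat
  assumes "simplicial_complex (V, H)"
    and "paving (V, H)"
    and "sdim (V, H) = d"
  shows "(\<exists>!H0. (V, H0) \<in> tau (V, H) \<and> (\<forall>H'. (V, H') \<in> tau (V, H) \<longrightarrow> H' \<subseteq> H0))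
    \<and> (\<forall>H0. (V, H0) \<in> tau (V, H) \<and> (\<forall>H'. (V, H') \<in> tau (V, H) \<longrightarrow> H' \<subseteq> H0)
           \<longrightarrow> (V, H0) = truncation (d + 1) (eps_complex (V, H)))"
proof -
  define K where "K = transversals V (eps (V, H)) \<inter> P_le (Suc d) V"
  have K: "(V, K) \<in> tau (V, H)"
    using transversals_eps_in_tau[OF assms(2)] assms(3) by (simp add: K_def)
  have "P_le d V \<subseteq> K"
    using P_le_subset_transversals_eps[OF assms(2)] assms(3) by (auto simp: K_def P_le_def)
  \<comment> \<open>The inclusion just shown handles the exceptional member of \<open>tau\<close>;
    all others come from \<open>TBPav\<close>.\<close>
  then have greatest: "H' \<subseteq> K" if "(V, H') \<in> tau (V, H)" for H'
    using that TBPav_subset_transversals_eps[of V H' H] assms(3) by (auto simp: tau_def K_def)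
  \<comment> \<open>Antisymmetry of inclusion identifies any greatest element with \<open>K\<close>,
    so both claims reduce to statements about \<open>K\<close>.\<close>
  have unique: "(V, H0) \<in> tau (V, H) \<and> (\<forall>H'. (V, H') \<in> tau (V, H) \<longrightarrow> H' \<subseteq> H0) \<longleftrightarrow> H0 = K"
    (is "?greatest H0 \<longleftrightarrow> _") for H0
  proof
    assume "?greatest H0"
    then show "H0 = K" using K greatest[of H0] by (intro equalityI) simp_all
  next
    assume "H0 = K"
    then show "?greatest H0" using K greatest by simp
  qed
  have "(V, K) = truncation (d + 1) (eps_complex (V, H))"
    by (simp add: eps_complex_eq truncation_def K_def)
  then show ?thesis unfolding unique by simp
qed

end
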